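(* Let $\mu$ be an atomic measure on $\mathbb{R}$ with jumps $w_k\ge 0$ at the integers $k\in\mathbb{Z}$ (that is, $\mu=\sum_{k\in\mathbb{Z}}w_k\delta_k$), where $0<\sum_{k\in\mathbb{Z}}w_k<\infty$, and let $\{p_n\}_{n\in\mathbb{Z}_+}$ be the orthonormal polynomials with respect to $\mu$. Set $r_{0,k}=\sqrt{w_k}$ for $k\in\mathbb{Z}$. Then the sequence $$\varphi_n(x)=\mathrm{i}^n\sum_{k=-\infty}^\infty r_{0,k}\,p_n(k)\,\mathrm{e}^{\mathrm{i}kx}=\mathrm{i}^n\sum_{k=-\infty}^\infty\sqrt{w_k}\,p_n(k)\,\mathrm{e}^{\mathrm{i}kx},\qquad n\in\mathbb{Z}_+,$$ is orthonormal in $L_2[-\pi,\pi]$, i.e. $\langle\varphi_m,\varphi_n\rangle=\delta_{m,n}$ for all $m,n\in\mathbb{Z}_+$.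
   Context: $\mathbb{Z}_+=\{0,1,2,\ldots\}$. The inner product on $L_2[-\pi,\pi]$ (complex-valued functions) is normalised as $\langle f,g\rangle=\frac{1}{2\pi}\int_{-\pi}^{\pi}f(x)\overline{g(x)}\,dx$, and the Fourier series defining $\varphi_n$ is understood as an $L_2[-\pi,\pi]$ function. It is understood that all moments of $\mu$ are finite and that infinitely many $w_k$ are nonzero, so that the orthonormal polynomials exist for all degrees: $p_n$ is a real polynomial of degree exactly $n$ with positive leading coefficient and $\sum_{k\in\mathbb{Z}}w_k\,p_m(k)p_n(k)=\delta_{m,n}$ for all $m,n\in\mathbb{Z}_+$. The numbers $r_{0,k}$ play the role of the Fourier coefficients that determine $\varphi_0$ (up to the constant $p_0$). *)

theory Defs
  imports
    "HOL-Analysis.Analysis"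
    "HOL-Computational_Algebra.Polynomial"
begin

text \<open>The measure \<open>\<mu> = \<Sum>\<^sub>k w\<^sub>k \<delta>\<^sub>k\<close> on the Borel sets of the reals, obtained by pushing the
  weighted counting measure on the integers forward along the inclusion.\<close>

definition jump_measure :: "(int \<Rightarrow> real) \<Rightarrow> real measure" where
  "jump_measure w =
     distr (density (count_space UNIV) (\<lambda>k. ennreal (w k))) borel real_of_int"

text \<open>The Bochner integral of a non-integrable function is \<open>0\<close>. The case \<open>m = n\<close> below therefore
  forces every \<open>(p n)\<^sup>2\<close> to be integrable, and then so are all the products.\<close>

definition orthonormal_polys :: "real measure \<Rightarrow> (nat \<Rightarrow> real poly) \<Rightarrow> bool" where
  "orthonormal_polys M p \<longleftrightarrow>
     (\<forall>n. degree (p n) = n \<and> lead_coeff (p n) > 0) \<and>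
     (\<forall>m n. (LINT x|M. poly (p m) x * poly (p n) x) = (if m = n then 1 else 0))"

text \<open>Elements of \<open>L\<^sub>2[-\<pi>, \<pi>]\<close> are represented by functions rather than by classes modulo
  null sets.\<close>

definition L2 :: "(real \<Rightarrow> complex) set" where
  "L2 = {f. f \<in> borel_measurable (lebesgue_on {-pi..pi}) \<and>
            integrable (lebesgue_on {-pi..pi}) (\<lambda>x. (cmod (f x))\<^sup>2)}"

definition L2_inner :: "(real \<Rightarrow> complex) \<Rightarrow> (real \<Rightarrow> complex) \<Rightarrow> complex" where
  "L2_inner f g =
     complex_of_real (1 / (2 * pi)) * (LINT x|lebesgue_on {-pi..pi}. f x * cnj (g x))"

definition L2_nrm :: "(real \<Rightarrow> complex) \<Rightarrow> real" where
  "L2_nrm f = sqrt (Re (L2_inner f f))"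

text \<open>\<open>f\<close> represents \<open>\<Sum>\<^sub>k c\<^sub>k e\<^bsup>ikx\<^esup>\<close>, with the symmetric partial sums converging in the norm
  of \<open>L\<^sub>2[-\<pi>, \<pi>]\<close>; pointwise convergence is not required.\<close>

definition has_L2_fourier_sum :: "(int \<Rightarrow> complex) \<Rightarrow> (real \<Rightarrow> complex) \<Rightarrow> bool" where
  "has_L2_fourier_sum c f \<longleftrightarrow>
     f \<in> L2 \<and>
     (\<lambda>N. L2_nrm (\<lambda>x. f x - (\<Sum>k = - int N..int N. c k * exp (\<i> * of_int k * of_real x))))
       \<longlonglongrightarrow> 0"

definition r0 :: "(int \<Rightarrow> real) \<Rightarrow> int \<Rightarrow> real" where
  "r0 w k = sqrt (w k)"

text \<open>\<open>f\<close> is a representative of \<open>\<phi>\<^sub>n\<close>, which is determined only up to null sets.\<close>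

definition is_phi ::
    "(int \<Rightarrow> real) \<Rightarrow> (nat \<Rightarrow> real poly) \<Rightarrow> nat \<Rightarrow> (real \<Rightarrow> complex) \<Rightarrow> bool" where
  "is_phi w p n f \<longleftrightarrow>
     (\<exists>S. has_L2_fourier_sum (\<lambda>k. complex_of_real (r0 w k * poly (p n) (of_int k))) S \<and>
          f = (\<lambda>x. \<i> ^ n * S x))"

end

theory Submission
  imports Defs
begin

text \<open>Finiteness of the moments makes the Fourier coefficients \<open>c\<^sub>k = sqrt (w\<^sub>k) p\<^sub>n(k)\<close> absolutely
  summable: \<open>|c\<^sub>k|\<close> is at most \<open>(1 + k\<^sup>2) c\<^sub>k\<^sup>2 + 1 / (1 + k\<^sup>2)\<close>, and the first term is summable because
  \<open>(1 + x\<^sup>2) p\<^sub>n(x)\<^sup>2\<close> is integrable. So the Fourier series converge uniformly, to continuous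
  representatives of \<open>\<phi>\<^sub>n\<close>, and their inner products are \<open>\<Sum>\<^sub>k c\<^sub>k d\<^sub>k\<close>, the integral of \<open>p\<^sub>m p\<^sub>n\<close>. Any
  other representative agrees with the continuous one almost everywhere.\<close>

section \<open>Integrals and sums over the integers\<close>

text \<open>Integrability over the counting measure is absolute summability, so the integral unfolds
  into an unordered sum; \<open>w k \<ge> 0\<close> keeps \<open>ennreal\<close> from truncating the
  weights.\<close>

lemma has_sum_integral_jump_measure:
  fixes f :: "real \<Rightarrow> real"
  assumes w: "\<And>k. w k \<ge> 0"
    and f: "integrable (jump_measure w) f"
  shows "((\<lambda>k. w k * f (of_int k)) has_sum (LINT x|jump_measure w. f x)) UNIV"
proof -
  have [measurable]: "f \<in> borel_measurable borel"
    using borel_measurable_integrable[OF f] by (simp add: jump_measure_def)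
  have "integrable (density (count_space UNIV) (\<lambda>k. ennreal (w k))) (\<lambda>k. f (of_int k))"
    using f unfolding jump_measure_def by (subst (asm) integrable_distr_eq) auto
  then have "integrable (count_space UNIV) (\<lambda>k. w k * f (of_int k))"
    by (subst (asm) integrable_real_density) (auto simp: w)
  then have abs: "Infinite_Set_Sum.abs_summable_on (\<lambda>k. w k * f (of_int k)) UNIV"
    by (simp add: Infinite_Set_Sum.abs_summable_on_def)
  then have "(\<lambda>k. w k * f (of_int k)) summable_on UNIV"
    using abs_summable_equivalent abs_summable_summable by blast
  then have sums: "((\<lambda>k. w k * f (of_int k)) has_sum (\<Sum>\<^sub>\<infinity>k. w k * f (of_int k))) UNIV"
    by (rule has_sum_infsum)
  have "(LINT x|jump_measure w. f x)
      = (LINT k|density (count_space UNIV) (\<lambda>k. ennreal (w k)). f (of_int k))"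
    unfolding jump_measure_def by (subst integral_distr) auto
  also have "\<dots> = (LINT k|count_space UNIV. w k * f (of_int k))"
    by (subst integral_real_density) (auto simp: w)
  also have "\<dots> = (\<Sum>\<^sub>\<infinity>k. w k * f (of_int k))"
    using infsetsum_infsum[OF abs] by (simp add: infsetsum_def)
  finally show ?thesis
    using sums by simp
qed

lemma integrable_poly:
  fixes q :: "real poly"
  assumes "\<And>j::nat. integrable M (\<lambda>x. x ^ j)"
  shows "integrable M (poly q)"
  unfolding poly_altdef using assms
  by (intro Bochner_Integration.integrable_sum integrable_mult_right) auto

lemma summable_on_int_inverse_squares:
  "(\<lambda>k::int. 1 / (1 + (of_int k)\<^sup>2 :: real)) summable_on UNIV"
proof -
  have nat: "(\<lambda>n::nat. 1 / (1 + (real n)\<^sup>2)) summable_on UNIV"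
  proof (rule norm_summable_imp_summable_on,
      rule summable_comparison_test[OF _ inverse_power_summable[of 2]])
    show "\<exists>N. \<forall>n\<ge>N. norm (norm (1 / (1 + (real n)\<^sup>2))) \<le> inverse (real n ^ 2)"
      \<comment> \<open>The bound starts at 1 because at 0 its right-hand side is
        \<open>inverse 0 = 0\<close>.\<close>
      by (intro exI[of _ 1] allI impI) (simp add: divide_inverse le_imp_inverse_le)
  qed simp
  have "(\<lambda>k::int. 1 / (1 + (of_int k)\<^sup>2 :: real)) summable_on range int"
    by (subst summable_on_reindex) (use nat in \<open>auto simp: o_def\<close>)
  moreover have "(\<lambda>k::int. 1 / (1 + (of_int k)\<^sup>2 :: real)) summable_on range (\<lambda>n. - int n)"
    by (subst summable_on_reindex) (use nat in \<open>auto simp: o_def inj_def\<close>)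
  ultimately have "(\<lambda>k::int. 1 / (1 + (of_int k)\<^sup>2 :: real))
      summable_on (range int \<union> range (\<lambda>n. - int n))"
    by (rule summable_on_union)
  moreover have "k \<in> range int \<union> range (\<lambda>n. - int n)" for k
    by (cases k rule: int_cases2) auto
  then have "range int \<union> range (\<lambda>n. - int n) = UNIV"
    by blast
  ultimately show ?thesis
    by simp
qed

text \<open>Passes from limits over all finite subsets, as in \<open>has_sum\<close>, to the
  symmetric partial sums of \<open>has_L2_fourier_sum\<close>.\<close>

lemma filterlim_symmetric_atLeastAtMost:
  "filterlim (\<lambda>N. {- int N..int N}) (finite_subsets_at_top UNIV) sequentially"
  unfolding filterlim_finite_subsets_at_top
proof (intro allI impI)
  fix X :: "int set"
  assume X: "finite X \<and> X \<subseteq> UNIV"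
  have "\<forall>\<^sub>F N in sequentially. x \<in> {- int N..int N}" for x :: int
    unfolding eventually_sequentially
    by (intro exI[of _ "nat \<bar>x\<bar>"]) auto
  then have "\<forall>\<^sub>F N in sequentially. \<forall>x\<in>X. x \<in> {- int N..int N}"
    using X by (subst eventually_ball_finite_distrib) auto
  then show "\<forall>\<^sub>F N in sequentially. finite {- int N..int N} \<and> X \<subseteq> {- int N..int N}
      \<and> {- int N..int N} \<subseteq> UNIV"
    by eventually_elim auto
qed

section \<open>Absolutely convergent trigonometric series\<close>

definition trig_poly :: "(int \<Rightarrow> complex) \<Rightarrow> nat \<Rightarrow> real \<Rightarrow> complex" where
  "trig_poly c N x = (\<Sum>k = - int N..int N. c k * exp (\<i> * of_int k * of_real x))"

text \<open>An unordered sum, to fit the M-test over finite subsets. Since \<open>infsum\<close> is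
  0 on families without a sum, the lemmas on \<open>trig_series\<close> assume absolute summability
  of \<open>c\<close>.\<close>

definition trig_series :: "(int \<Rightarrow> complex) \<Rightarrow> real \<Rightarrow> complex" where
  "trig_series c x = (\<Sum>\<^sub>\<infinity>k. c k * exp (\<i> * of_int k * of_real x))"

lemma continuous_on_trig_poly: "continuous_on A (trig_poly c N)"
  unfolding trig_poly_def by (intro continuous_intros)

text \<open>The exponentials have modulus 1, so \<open>cmod (c k)\<close> is a majorant for the
  Weierstrass test.\<close>

lemma uniform_limit_trig_series:
  assumes "(\<lambda>k. cmod (c k)) summable_on UNIV"
  shows "uniform_limit A (trig_poly c) (trig_series c) sequentially"
proof -
  have "uniform_limit A (\<lambda>X x. \<Sum>k\<in>X. c k * exp (\<i> * of_int k * of_real x))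
          (trig_series c) (finite_subsets_at_top UNIV)"
    unfolding trig_series_def
    by (rule Weierstrass_m_test_general[where M = "\<lambda>k. cmod (c k)"])
      (use assms in \<open>auto simp: norm_mult\<close>)
  from filterlim_compose[OF this filterlim_symmetric_atLeastAtMost]
  show ?thesis
    by (simp add: trig_poly_def[abs_def] fun_eq_iff)
qed

lemma continuous_on_trig_series:
  assumes "(\<lambda>k. cmod (c k)) summable_on UNIV"
  shows "continuous_on A (trig_series c)"
  by (rule uniform_limit_theorem[OF _ uniform_limit_trig_series[OF assms]])
    (auto intro!: always_eventually continuous_on_trig_poly)

text \<open>A bound free of \<open>N\<close> and \<open>x\<close>, as dominated convergence
  requires.\<close>

lemma norm_trig_poly_le:
  assumes "(\<lambda>k. cmod (c k)) summable_on UNIV"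
  shows "cmod (trig_poly c N x) \<le> (\<Sum>\<^sub>\<infinity>k. cmod (c k))"
proof -
  have "cmod (trig_poly c N x) \<le> (\<Sum>k = - int N..int N. cmod (c k))"
    unfolding trig_poly_def by (rule order_trans[OF norm_sum]) (simp add: norm_mult)
  also have "\<dots> \<le> (\<Sum>\<^sub>\<infinity>k. cmod (c k))"
    using assms by (intro finite_sum_le_infsum) auto
  finally show ?thesis .
qed

text \<open>For \<open>k \<noteq> l\<close> the antiderivative \<open>exp (a * x) / a\<close> is
  periodic with period 2 pi, so its boundary values cancel.\<close>

lemma L2_inner_exp:
  "L2_inner (\<lambda>x. exp (\<i> * of_int k * of_real x)) (\<lambda>x. exp (\<i> * of_int l * of_real x))
     = (if k = l then 1 else 0)"
proof -
  let ?f = "\<lambda>x::real. exp (\<i> * of_int (k - l) * of_real x)"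
  have eq: "exp (\<i> * of_int k * of_real x) * cnj (exp (\<i> * of_int l * of_real x)) = ?f x" for x
    by (simp add: exp_cnj flip: exp_add) (simp add: algebra_simps)
  have "(LINT x|lebesgue_on {-pi..pi}. ?f x) = integral {-pi..pi} ?f"
    by (intro lebesgue_integral_eq_integral continuous_imp_integrable_real continuous_intros) auto
  also have "\<dots> = (if k = l then 2 * of_real pi else 0)"
  proof (cases "k = l")
    case False
    define a where "a = \<i> * of_int (k - l)"
    have a: "a \<noteq> 0" using False by (simp add: a_def)
    have "((\<lambda>x. exp (a * of_real x)) has_integral
            exp (a * of_real pi) / a - exp (a * of_real (- pi)) / a) {-pi..pi}"
      by (rule fundamental_theorem_of_calculus)
        (use a in \<open>auto intro!: derivative_eq_intros has_vector_derivative_real_field\<close>)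
    \<comment> \<open>The exponents differ by 2 pi i times \<open>k - l\<close>, which is the
      witness for \<open>exp_eq\<close>.\<close>
    moreover have "exp (a * of_real pi) = exp (a * of_real (- pi))"
      unfolding exp_eq by (intro exI[of _ "k - l"]) (simp add: a_def)
    ultimately show ?thesis
      using False by (simp add: a_def integral_unique)
  qed (simp add: scaleR_conv_of_real)
  finally show ?thesis
    by (simp add: L2_inner_def eq)
qed

text \<open>Orthonormality of the exponentials collapses the double sum to its diagonal.\<close>

lemma L2_inner_trig_poly:
  "L2_inner (trig_poly c N) (trig_poly d N) = (\<Sum>k = - int N..int N. c k * cnj (d k))"
proof -
  let ?I = "{- int N..int N}"
  let ?e = "\<lambda>k x. exp (\<i> * of_int k * of_real x)"
  have "trig_poly c N x * cnj (trig_poly d N x)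
      = (\<Sum>k\<in>?I. \<Sum>l\<in>?I. c k * cnj (d l) * (?e k x * cnj (?e l x)))" for x
    by (simp add: trig_poly_def sum_product mult_ac)
  moreover have "integrable (lebesgue_on {-pi..pi}) (\<lambda>x. ?e k x * cnj (?e l x))" for k l
    by (intro continuous_imp_integrable_real continuous_intros)
  ultimately have "L2_inner (trig_poly c N) (trig_poly d N)
      = (\<Sum>k\<in>?I. \<Sum>l\<in>?I. c k * cnj (d l) * L2_inner (?e k) (?e l))"
    by (simp add: L2_inner_def sum_distrib_left mult_ac)
  also have "\<dots> = (\<Sum>k\<in>?I. c k * cnj (d k))"
    by (simp add: L2_inner_exp if_distrib cong: if_cong)
  finally show ?thesis .
qed

text \<open>Parseval's identity in the limit: the partial sums converge pointwise under a constant
  majorant, which is integrable on a bounded interval.\<close>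

lemma L2_inner_trig_series:
  assumes c: "(\<lambda>k. cmod (c k)) summable_on UNIV" and d: "(\<lambda>k. cmod (d k)) summable_on UNIV"
  shows "(\<lambda>N. \<Sum>k = - int N..int N. c k * cnj (d k))
           \<longlonglongrightarrow> L2_inner (trig_series c) (trig_series d)"
proof -
  let ?M = "lebesgue_on {-pi..pi}"
  have lim: "(\<lambda>N. trig_poly c N x) \<longlonglongrightarrow> trig_series c x"
    if "(\<lambda>k. cmod (c k)) summable_on UNIV" for c x
    using uniform_limit_trig_series[OF that, of UNIV] by (rule tendsto_uniform_limitI) simp
  have "(\<lambda>N. LINT x|?M. trig_poly c N x * cnj (trig_poly d N x))
      \<longlonglongrightarrow> (LINT x|?M. trig_series c x * cnj (trig_series d x))"
  proof (rule integral_dominated_convergence)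
    show "(\<lambda>x. trig_series c x * cnj (trig_series d x)) \<in> borel_measurable ?M"
      by (intro continuous_imp_measurable_on_sets_lebesgue continuous_intros
          continuous_on_trig_series c d) auto
    show "(\<lambda>x. trig_poly c N x * cnj (trig_poly d N x)) \<in> borel_measurable ?M" for N
      by (intro continuous_imp_measurable_on_sets_lebesgue continuous_intros
          continuous_on_trig_poly) auto
    show "integrable ?M (\<lambda>x. (\<Sum>\<^sub>\<infinity>k. cmod (c k)) * (\<Sum>\<^sub>\<infinity>k. cmod (d k)))"
      by (intro continuous_imp_integrable_real continuous_intros)
    show "AE x in ?M. (\<lambda>N. trig_poly c N x * cnj (trig_poly d N x))
        \<longlonglongrightarrow> trig_series c x * cnj (trig_series d x)"
      by (intro AE_I2 tendsto_intros lim c d)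
    show "AE x in ?M. norm (trig_poly c N x * cnj (trig_poly d N x))
        \<le> (\<Sum>\<^sub>\<infinity>k. cmod (c k)) * (\<Sum>\<^sub>\<infinity>k. cmod (d k))" for N
      by (auto simp: norm_mult intro!: mult_mono norm_trig_poly_le c d infsum_nonneg)
  qed
  then show ?thesis
    unfolding L2_inner_trig_poly[symmetric] L2_inner_def by (intro tendsto_intros)
qed

section \<open>Convergence and uniqueness in the space \<open>L2\<close>\<close>

lemma L2_nrm_eq:
  "L2_nrm f = sqrt (1 / (2 * pi) * (LINT x|lebesgue_on {-pi..pi}. (cmod (f x))\<^sup>2))"
proof -
  have "(LINT x|lebesgue_on {-pi..pi}. f x * cnj (f x))
      = of_real (LINT x|lebesgue_on {-pi..pi}. (cmod (f x))\<^sup>2)"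
    by (subst complex_norm_square[symmetric]) (rule integral_complex_of_real)
  then show ?thesis
    by (simp add: L2_nrm_def L2_inner_def)
qed

lemma continuous_on_imp_L2:
  assumes "continuous_on {-pi..pi} f"
  shows "f \<in> L2"
  unfolding L2_def using assms
  by (auto intro!: continuous_imp_measurable_on_sets_lebesgue continuous_imp_integrable_real
      continuous_intros)

text \<open>Stands in for the triangle inequality of \<open>L2_nrm\<close>: with
  \<open>z = 0\<close> it gives closure of \<open>L2\<close> under differences, with
  \<open>z\<close> a partial sum it gives uniqueness of limits.\<close>

lemma norm_diff_square_le:
  fixes u v z :: "'a::real_normed_vector"
  shows "(norm (u - v))\<^sup>2 \<le> 2 * (norm (u - z))\<^sup>2 + 2 * (norm (v - z))\<^sup>2"
  using norm_triangle_ineq4[of "u - z" "v - z"]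
    sum_squares_bound[of "norm (u - z)" "norm (v - z)"]
    power_mono[of "norm (u - v)" "norm (u - z) + norm (v - z)" 2]
  by (simp add: power2_sum)

lemma L2_diff:
  assumes f: "f \<in> L2" and g: "g \<in> L2"
  shows "(\<lambda>x. f x - g x) \<in> L2"
proof -
  let ?M = "lebesgue_on {-pi..pi}"
  have m: "(\<lambda>x. f x - g x) \<in> borel_measurable ?M"
    using assms by (auto simp: L2_def)
  have "integrable ?M (\<lambda>x. 2 * (cmod (f x))\<^sup>2 + 2 * (cmod (g x))\<^sup>2)"
    using assms by (auto simp: L2_def)
  then have "integrable ?M (\<lambda>x. (cmod (f x - g x))\<^sup>2)"
    by (rule Bochner_Integration.integrable_bound)
      (use m norm_diff_square_le[of "f _" "g _" 0] in \<open>auto intro!: AE_I2\<close>)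
  with m show ?thesis
    by (simp add: L2_def)
qed

text \<open>The normalisation gives the interval total mass 1, so uniform convergence implies
  \<open>L2\<close> convergence.\<close>

lemma L2_nrm_le:
  assumes f: "f \<in> L2" and e: "\<And>x. x \<in> {-pi..pi} \<Longrightarrow> cmod (f x) \<le> e"
  shows "L2_nrm f \<le> e"
proof -
  have e0: "0 \<le> e"
    using order_trans[OF norm_ge_zero e[of 0]] by simp
  have "(LINT x|lebesgue_on {-pi..pi}. (cmod (f x))\<^sup>2) \<le> (LINT x|lebesgue_on {-pi..pi}. e\<^sup>2)"
    using f by (intro integral_mono) (auto simp: L2_def intro!: power_mono e)
  also have "\<dots> = 2 * pi * e\<^sup>2"
    by (simp add: measure_restrict_space)
  finally have "1 / (2 * pi) * (LINT x|lebesgue_on {-pi..pi}. (cmod (f x))\<^sup>2) \<le> e\<^sup>2"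
    by (simp add: field_simps)
  then show ?thesis
    unfolding L2_nrm_eq by (intro real_le_lsqrt e0)
qed

lemma has_L2_fourier_sum_trig_series:
  assumes "(\<lambda>k. cmod (c k)) summable_on UNIV"
  shows "has_L2_fourier_sum c (trig_series c)"
proof -
  have "(\<lambda>N. L2_nrm (\<lambda>x. trig_series c x - trig_poly c N x)) \<longlonglongrightarrow> 0"
  proof (rule tendstoI)
    fix e :: real
    assume "e > 0"
    \<comment> \<open>Half of \<open>e\<close>, because \<open>L2_nrm_le\<close> yields only a
      non-strict bound.\<close>
    then have "\<forall>\<^sub>F N in sequentially. \<forall>x\<in>UNIV. dist (trig_poly c N x) (trig_series c x) < e / 2"
      using uniform_limit_trig_series[OF assms, of UNIV] by (auto dest: uniform_limitD[where e = "e/2"])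
    then show "\<forall>\<^sub>F N in sequentially.
        dist (L2_nrm (\<lambda>x. trig_series c x - trig_poly c N x)) 0 < e"
    proof eventually_elim
      case (elim N)
      have "(\<lambda>x. trig_series c x - trig_poly c N x) \<in> L2"
        by (intro continuous_on_imp_L2 continuous_intros continuous_on_trig_series
            continuous_on_trig_poly assms)
      then have "L2_nrm (\<lambda>x. trig_series c x - trig_poly c N x) \<le> e / 2"
        by (rule L2_nrm_le) (use elim in \<open>auto simp: dist_norm norm_minus_commute intro: less_imp_le\<close>)
      moreover have "0 \<le> L2_nrm (\<lambda>x. trig_series c x - trig_poly c N x)"
        by (simp add: L2_nrm_eq)
      ultimately show ?case
        using \<open>e > 0\<close> by simp
    qed
  qed
  then show ?thesis
    unfolding has_L2_fourier_sum_def trig_poly_def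
    using assms by (intro conjI continuous_on_imp_L2 continuous_on_trig_series)
qed

text \<open>Both functions are limits of the same partial sums, so the integral \<open>Q\<close> of
  the squared difference lies below a null sequence.\<close>

lemma has_L2_fourier_sum_AE_unique:
  assumes f: "has_L2_fourier_sum c f" and g: "has_L2_fourier_sum c g"
  shows "AE x in lebesgue_on {-pi..pi}. f x = g x"
proof -
  let ?M = "lebesgue_on {-pi..pi}"
  define Q where "Q h = (LINT x|?M. (cmod (h x))\<^sup>2)" for h :: "real \<Rightarrow> complex"
  have Q: "Q h = 2 * pi * (L2_nrm h)\<^sup>2" for h
    by (simp add: L2_nrm_eq Q_def)
  have lim: "(\<lambda>N. Q (\<lambda>x. f x - trig_poly c N x)) \<longlonglongrightarrow> 0" if "has_L2_fourier_sum c f" for f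
    using that tendsto_mult[OF tendsto_const tendsto_power[where n = 2], of _ 0 sequentially "2 * pi"]
    unfolding has_L2_fourier_sum_def Q trig_poly_def by fastforce
  have P: "trig_poly c N \<in> L2" for N
    by (intro continuous_on_imp_L2 continuous_on_trig_poly)
  have L2: "f \<in> L2" "g \<in> L2"
    using f g by (auto simp: has_L2_fourier_sum_def)
  note int = L2_diff[OF L2] L2_diff[OF L2(1) P] L2_diff[OF L2(2) P]
  have "Q (\<lambda>x. f x - g x) \<le> 2 * Q (\<lambda>x. f x - trig_poly c N x) + 2 * Q (\<lambda>x. g x - trig_poly c N x)"
    for N
  proof -
    have "Q (\<lambda>x. f x - g x)
        \<le> (LINT x|?M. 2 * (cmod (f x - trig_poly c N x))\<^sup>2 + 2 * (cmod (g x - trig_poly c N x))\<^sup>2)"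
      unfolding Q_def by (rule integral_mono) (use int in \<open>auto simp: L2_def norm_diff_square_le\<close>)
    also have "\<dots> = 2 * Q (\<lambda>x. f x - trig_poly c N x) + 2 * Q (\<lambda>x. g x - trig_poly c N x)"
      unfolding Q_def using int by (subst Bochner_Integration.integral_add) (auto simp: L2_def)
    finally show ?thesis .
  qed
  moreover have "(\<lambda>N. 2 * Q (\<lambda>x. f x - trig_poly c N x) + 2 * Q (\<lambda>x. g x - trig_poly c N x))
      \<longlonglongrightarrow> 2 * 0 + 2 * 0"
    by (intro tendsto_intros lim f g)
  ultimately have "Q (\<lambda>x. f x - g x) \<le> 2 * 0 + 2 * 0"
    by (intro tendsto_lowerbound[of _ _ sequentially]) auto
  moreover have "0 \<le> Q (\<lambda>x. f x - g x)"
    by (simp add: Q_def)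
  ultimately have "Q (\<lambda>x. f x - g x) = 0"
    by simp
  \<comment> \<open>Integrability from \<open>int\<close> is essential: a non-integrable square
    would also have integral 0.\<close>
  then have "AE x in ?M. (cmod (f x - g x))\<^sup>2 = 0"
    unfolding Q_def by (subst (asm) integral_nonneg_eq_0_iff_AE) (use int in \<open>auto simp: L2_def\<close>)
  then show ?thesis
    by simp
qed

text \<open>Carries Parseval's identity from the continuous representatives to arbitrary ones, as
  inner products ignore null sets.\<close>

lemma L2_inner_fourier_sum:
  assumes c: "(\<lambda>k. cmod (c k)) summable_on UNIV" and d: "(\<lambda>k. cmod (d k)) summable_on UNIV"
    and f: "has_L2_fourier_sum c f" and g: "has_L2_fourier_sum d g"
  shows "(\<lambda>N. \<Sum>k = - int N..int N. c k * cnj (d k)) \<longlonglongrightarrow> L2_inner f g"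
proof -
  let ?M = "lebesgue_on {-pi..pi}"
  have m: "h \<in> borel_measurable ?M" if "has_L2_fourier_sum a h" for a h
    using that by (auto simp: has_L2_fourier_sum_def L2_def)
  have [measurable]: "cnj \<in> borel_measurable borel"
    by (intro borel_measurable_continuous_onI continuous_intros)
  note [measurable] = m[OF f] m[OF g] m[OF has_L2_fourier_sum_trig_series[OF c]]
    m[OF has_L2_fourier_sum_trig_series[OF d]]
  have "AE x in ?M. f x * cnj (g x) = trig_series c x * cnj (trig_series d x)"
    using has_L2_fourier_sum_AE_unique[OF f has_L2_fourier_sum_trig_series[OF c]]
      has_L2_fourier_sum_AE_unique[OF g has_L2_fourier_sum_trig_series[OF d]]
    by eventually_elim simp
  then have "L2_inner f g = L2_inner (trig_series c) (trig_series d)"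
    unfolding L2_inner_def by (intro arg_cong2[where f = "(*)"] refl integral_cong_AE) auto
  with L2_inner_trig_series[OF c d] show ?thesis
    by simp
qed

section \<open>The coefficients of the functions \<phi> and their orthonormality\<close>

text \<open>Moments up to order \<open>2 * degree q + 2\<close> pay for the weight 1 + k^2 on the
  squared coefficients.\<close>

lemma abs_summable_r0_poly:
  fixes q :: "real poly"
  assumes w: "\<And>k. w k \<ge> 0" and mom: "\<And>j::nat. integrable (jump_measure w) (\<lambda>x. x ^ j)"
  shows "(\<lambda>k. cmod (complex_of_real (r0 w k * poly q (of_int k)))) summable_on UNIV"
proof -
  define s where "s k = \<bar>r0 w k * poly q (of_int k)\<bar>" for k
  define a where "a k = 1 + (real_of_int k)\<^sup>2" for k
  have a: "a k > 0" for k
    by (simp add: a_def add_pos_nonneg)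
  \<comment> \<open>\<open>[:1, 0, 1:]\<close> is 1 + x^2, so the weighted squares are the terms of
    the integral of a single polynomial.\<close>
  have eq: "w k * poly (q * q * [:1, 0, 1:]) (of_int k) = (s k)\<^sup>2 * a k" for k
    using w[of k] by (simp add: s_def a_def r0_def power_mult_distrib)
      (simp add: power2_eq_square algebra_simps)
  have "(\<lambda>k. w k * poly (q * q * [:1, 0, 1:]) (of_int k)) summable_on UNIV"
    by (rule has_sum_imp_summable[OF has_sum_integral_jump_measure])
      (rule w integrable_poly mom)+
  then have "(\<lambda>k. (s k)\<^sup>2 * a k + 1 / a k) summable_on UNIV"
    unfolding eq using summable_on_int_inverse_squares
    by (intro summable_on_add) (auto simp: a_def)
  moreover have "s k \<le> (s k)\<^sup>2 * a k + 1 / a k" for k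
  proof -
    \<comment> \<open>The two factors are chosen so that \<open>sqrt (a k)\<close> cancels in their
      product, leaving \<open>2 * s k\<close>.\<close>
    have "2 * (s k * sqrt (a k)) * (1 / sqrt (a k)) \<le> (s k * sqrt (a k))\<^sup>2 + (1 / sqrt (a k))\<^sup>2"
      by (rule sum_squares_bound)
    then have "2 * s k \<le> (s k)\<^sup>2 * a k + 1 / a k"
      using a[of k] by (simp add: power_mult_distrib power_divide)
    moreover have "0 \<le> s k"
      by (simp add: s_def)
    ultimately show ?thesis
      by simp
  qed
  ultimately have "s summable_on UNIV"
    by (rule summable_on_comparison_test) (simp_all add: s_def)
  then show ?thesis
    by (simp only: s_def[abs_def] norm_of_real)
qed

text \<open>The existence conjunct keeps the second one, which ranges over all choices of
  representatives, from being vacuous.\<close>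

theorem theorem5:
  fixes w :: "int \<Rightarrow> real" and p :: "nat \<Rightarrow> real poly"
  assumes "\<And>k. w k \<ge> 0"
    and "w summable_on UNIV"
    and "0 < (\<Sum>\<^sub>\<infinity>k. w k)"
    and "infinite {k. w k \<noteq> 0}"
    and "\<And>j::nat. integrable (jump_measure w) (\<lambda>x. x ^ j)"
    and "orthonormal_polys (jump_measure w) p"
  shows "(\<forall>n. \<exists>f. is_phi w p n f) \<and>
    (\<forall>\<phi>. (\<forall>n. is_phi w p n (\<phi> n)) \<longrightarrow>
      (\<forall>n. \<phi> n \<in> L2) \<and>
      (\<forall>m n. L2_inner (\<phi> m) (\<phi> n) = (if m = n then 1 else 0)))"
proof (intro conjI allI impI)
  define c where "c n k = complex_of_real (r0 w k * poly (p n) (of_int k))" for n k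
  have c: "(\<lambda>k. cmod (c n k)) summable_on UNIV" for n
    unfolding c_def using assms(1,5) by (rule abs_summable_r0_poly)
  have phi: "is_phi w p n f \<longleftrightarrow> (\<exists>S. has_L2_fourier_sum (c n) S \<and> f = (\<lambda>x. \<i> ^ n * S x))" for n f
    by (simp add: is_phi_def c_def[abs_def])
  show "\<exists>f. is_phi w p n f" for n
    unfolding phi using has_L2_fourier_sum_trig_series[OF c] by blast
  fix \<phi>
  assume "\<forall>n. is_phi w p n (\<phi> n)"
  then obtain S where S: "\<And>n. has_L2_fourier_sum (c n) (S n)"
      and \<phi>: "\<And>n. \<phi> n = (\<lambda>x. \<i> ^ n * S n x)"
    unfolding phi by metis
  show "\<phi> n \<in> L2" for n
    using S[of n] by (auto simp: has_L2_fourier_sum_def L2_def \<phi> norm_mult norm_power)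
  fix m n
  have "((\<lambda>k. w k * poly (p m * p n) (of_int k))
      has_sum (LINT x|jump_measure w. poly (p m * p n) x)) UNIV"
    by (intro has_sum_integral_jump_measure integrable_poly assms)
  also have "(LINT x|jump_measure w. poly (p m * p n) x) = (if m = n then 1 else 0)"
    using assms(6) by (simp add: orthonormal_polys_def)
  finally have "((\<lambda>k. w k * poly (p m * p n) (of_int k)) has_sum (if m = n then 1 else 0)) UNIV" .
  then have "((\<lambda>k. complex_of_real (w k * poly (p m * p n) (of_int k)))
      has_sum complex_of_real (if m = n then 1 else 0)) UNIV"
    by (rule has_sum_of_real)
  moreover have "complex_of_real (w k * poly (p m * p n) (of_int k)) = c m k * cnj (c n k)" for k
  proof -
    \<comment> \<open>The two square roots multiply back to \<open>w k\<close>; the coefficients are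
      real, so conjugation fixes them.\<close>
    have "w k * poly (p m * p n) (of_int k)
        = (r0 w k * poly (p m) (of_int k)) * (r0 w k * poly (p n) (of_int k))"
      using assms(1)[of k] by (simp add: r0_def)
    then show ?thesis
      by (simp only: c_def of_real_mult complex_cnj_complex_of_real complex_cnj_mult)
  qed
  ultimately have "((\<lambda>k. c m k * cnj (c n k)) has_sum (if m = n then 1 else 0)) UNIV"
    by (simp split: if_splits)
  \<comment> \<open>The same symmetric sums also converge to \<open>L2_inner (S m) (S n)\<close>, so
    the two limits agree.\<close>
  then have "(\<lambda>N. \<Sum>k = - int N..int N. c m k * cnj (c n k)) \<longlonglongrightarrow> (if m = n then 1 else 0)"
    unfolding has_sum_def by (rule filterlim_compose[OF _ filterlim_symmetric_atLeastAtMost])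
  then have "L2_inner (S m) (S n) = (if m = n then 1 else 0)"
    using L2_inner_fourier_sum[OF c c S S] LIMSEQ_unique by blast
  moreover have "L2_inner (\<phi> m) (\<phi> n) = \<i> ^ m * cnj (\<i> ^ n) * L2_inner (S m) (S n)"
  proof -
    have "\<phi> m x * cnj (\<phi> n x) = \<i> ^ m * cnj (\<i> ^ n) * (S m x * cnj (S n x))" for x
      by (simp add: \<phi>)
    then show ?thesis
      by (simp add: L2_inner_def del: complex_cnj_power)
  qed
  \<comment> \<open>Only the diagonal needs the phase factor; for \<open>m \<noteq> n\<close> it
    multiplies 0.\<close>
  moreover have "\<i> ^ n * cnj (\<i> ^ n) = 1"
    by (simp add: complex_norm_square[symmetric] norm_power del: complex_cnj_power)
  ultimately show "L2_inner (\<phi> m) (\<phi> n) = (if m = n then 1 else 0)"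
    by simp
qed

end
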